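(* The class of amenable cyclic $t$-shapes is strictly larger than the class of CG-good cyclic $t$-shapes: every CG-good cyclic $t$-shape is amenable, and there is an amenable cyclic $t$-shape which is not CG-good.
   Context: A $t$-shape of width $w\ge 1$ is a finite formal sequence $t^{\varepsilon_1}t^{\varepsilon_2}\cdots t^{\varepsilon_w}$ with each $\varepsilon_i\in\{1,-1\}$ (no cancellation is performed); a cyclic $t$-shape is a $t$-shape considered up to cyclic permutation. For $m\ge 1$, $t^m$ abbreviates $tt\cdots t$ ($m$ letters) and $t^{-m}$ abbreviates $t^{-1}t^{-1}\cdots t^{-1}$ ($m$ letters). Inversion is the operation of replacing a cyclic $t$-shape by its formal inverse (reverse the order and change the sign of every exponent). Magnus derivative $D$: arrange the signs of the exponents of a cyclic $t$-shape $T$ around a circle. Between each two cyclically consecutive signs $+,+$ insert a new $+$; between each two cyclically consecutive signs $-,-$ insert a new $-$; in all other cases insert nothing. Then delete the original signs. The remaining cyclic sequence of (new) signs defines $D(T)$, which may be empty; $D$ of the empty sequence is empty. (For width $1$, the single letter is cyclically adjacent to itself, so $D(t)=t$.) $D^n$ is the $n$-fold iterate, $D^0(T)=T$. Blocks and blow-ups: for an integer $m\ge 0$, an $m$-block is a finite, possibly empty, non-cyclic sequence $t^{\varepsilon_1}\cdots t^{\varepsilon_k}$, $\varepsilon_i=\pm1$, with total sum $\varepsilon_1+\dots+\varepsilon_k=0$ and all of whose partial sums $\varepsilon_1+\dots+\varepsilon_i$ ($0\le i\le k$) lie in $[-m,0]$. It is full if some partial sum (including the empty one) equals $-m$. An $m$-blow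 up of a cyclic $t$-shape $T$ is any cyclic $t$-shape obtained by inserting, between each pair of cyclically consecutive letters of $T$, an $m$-block, where the block inserted between a pair $t^{-1},t$ (in this order) must be full; the blocks are otherwise arbitrary and chosen independently. Clumps: a clump in a cyclic $t$-shape is a maximal connected (cyclically consecutive) subsequence of the form $t^m$ with $|m|>1$; it is an up clump if $m>0$ and a down clump if $m<0$. A one-clump shape is a cyclic $t$-shape with exactly one clump, which is not the whole sequence; i.e. after possible cyclic permutation and inversion it is $t^mt^{-1}(tt^{-1})^r$ with $m>1$, $r\ge 0$. A cyclic $t$-shape is suitable if it has exactly one up clump, which is not the whole sequence, and possibly some down clumps, or if it has exactly one down clump, which is not the whole sequence, and possibly some up clumps; i.e. after possible cyclic permutation and inversion it is $t^st^{-r_0}tt^{-r_1}t\cdots tt^{-r_k}$ with $s>1$, $k\ge 0$, $r_i\ge 1$. CG-good: a cyclic $t$-shape $T$ is CG-good if $D^n(T)$ is a one-clump shape for some integer $n\ge 0$. Amenability: a cyclic $t$-shape is amenable if it is an $m$-blow up of a suitable $t$-shape for some integer $m\ge 0$; in addition, by convention, the cyclic $t$-shape $tt^{-1}$ is declared to be amenable. *)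

theory Defs
  imports Main
begin

text \<open>Letters, with \<open>Up\<close> standing for \<open>t\<close> and \<open>Dn\<close> for its formal inverse.\<close>

datatype letter = Up | Dn

fun expo :: "letter \<Rightarrow> int" where
  "expo Up = 1"
| "expo Dn = - 1"

definition rot_eq :: "letter list \<Rightarrow> letter list \<Rightarrow> bool" where
  "rot_eq xs ys \<longleftrightarrow> (\<exists>k. ys = rotate k xs)"

lemma rotate_undo:
  fixes xs :: "'a list"
  shows "\<exists>j. rotate j (rotate k xs) = xs"
proof (cases "xs = []")
  case False
  let ?n = "length xs"
  have "(?n - k mod ?n + k) mod ?n = (?n - k mod ?n + k mod ?n) mod ?n"
    by (simp add: mod_add_right_eq)
  also have "\<dots> = 0"
    using False by (simp add: less_imp_le)
  finally have "rotate (?n - k mod ?n) (rotate k xs) = xs"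
    by (simp add: rotate_rotate rotate_conv_mod[of "?n - k mod ?n + k"])
  then show ?thesis by blast
qed simp

lemma equivp_rot_eq: "equivp rot_eq"
proof (rule equivpI)
  show "reflp rot_eq"
    unfolding rot_eq_def by (rule reflpI) (metis rotate0 id_apply)
  show "symp rot_eq"
    unfolding rot_eq_def by (rule sympI) (metis rotate_undo)
  show "transp rot_eq"
    unfolding rot_eq_def by (rule transpI) (metis rotate_rotate)
qed

text \<open>
  Finite sequences up to cyclic permutation.  The type contains the empty sequence, because a
  Magnus derivative may be empty; the cyclic \<open>t\<close>-shapes are the elements of width at least 1.
\<close>

quotient_type cyclic_seq = "letter list" / rot_eq morphisms rep_cyc cyc
  by (rule equivp_rot_eq)

lift_definition width :: "cyclic_seq \<Rightarrow> nat" is length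
  by (auto simp: rot_eq_def)

definition cyclic_shapes :: "cyclic_seq set" where
  "cyclic_shapes = {T. 1 \<le> width T}"

text \<open>
  \<open>zip xs (rotate1 xs)\<close> lists the pairs of cyclically consecutive letters; a single letter is
  paired with itself.
\<close>

definition deriv_list :: "letter list \<Rightarrow> letter list" where
  "deriv_list xs = map fst (filter (\<lambda>(a, b). a = b) (zip xs (rotate1 xs)))"

lemma filter_rotate: "\<exists>j. filter P (rotate k xs) = rotate j (filter P xs)"
proof -
  let ?m = "k mod length xs"
  have "filter P (rotate k xs) = filter P (drop ?m xs) @ filter P (take ?m xs)"
    by (simp only: rotate_drop_take filter_append)
  also have "\<dots> = rotate (length (filter P (take ?m xs)))
      (filter P (take ?m xs) @ filter P (drop ?m xs))"
    by (simp only: rotate_append)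
  also have "filter P (take ?m xs) @ filter P (drop ?m xs) = filter P xs"
    by (metis append_take_drop_id filter_append)
  finally show ?thesis by blast
qed

lemma zip_rotate:
  assumes "length xs = length ys"
  shows "zip (rotate k xs) (rotate k ys) = rotate k (zip xs ys)"
proof (rule nth_equalityI)
  fix i assume "i < length (zip (rotate k xs) (rotate k ys))"
  then have i: "i < length ys" using assms by simp
  then have "0 < length ys" by linarith
  then have "(k + i) mod length ys < length ys" by (rule mod_less_divisor)
  then show "zip (rotate k xs) (rotate k ys) ! i = rotate k (zip xs ys) ! i"
    using assms i by (simp add: nth_rotate)
qed (use assms in simp)

lift_definition magnus_D :: "cyclic_seq \<Rightarrow> cyclic_seq" is deriv_list
proof -
  fix xs ys assume "rot_eq xs ys"
  then obtain k where k: "ys = rotate k xs" by (auto simp: rot_eq_def)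
  have "rotate1 (rotate k xs) = rotate k (rotate1 xs)"
    by (rule rotate1_rotate_swap)
  then have "zip ys (rotate1 ys) = rotate k (zip xs (rotate1 xs))"
    by (simp add: k zip_rotate)
  then show "rot_eq (deriv_list xs) (deriv_list ys)"
    unfolding deriv_list_def rot_eq_def by (metis filter_rotate rotate_map)
qed

text \<open>
  A cyclically consecutive subsequence is recorded by its set of positions in a representing
  list.  In this way a constant sequence of width at least 2 has exactly one clump, namely the
  set of all positions.
\<close>

definition arc :: "nat \<Rightarrow> nat \<Rightarrow> nat \<Rightarrow> nat set" where
  "arc n i l = (\<lambda>j. (i + j) mod n) ` {..<l}"

definition run :: "letter \<Rightarrow> letter list \<Rightarrow> nat set \<Rightarrow> bool" where
  "run a xs A \<longleftrightarrow>
     (\<exists>i l. i < length xs \<and> 1 < l \<and> l \<le> length xs \<and> A = arc (length xs) i l) \<and>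
     (\<forall>p\<in>A. xs ! p = a)"

definition clumps :: "letter \<Rightarrow> letter list \<Rightarrow> nat set set" where
  "clumps a xs = {A. run a xs A \<and> (\<forall>B. run a xs B \<longrightarrow> A \<subseteq> B \<longrightarrow> B = A)}"

definition sole_proper_clump :: "nat set set \<Rightarrow> letter list \<Rightarrow> bool" where
  "sole_proper_clump C xs \<longleftrightarrow> (\<exists>A. C = {A} \<and> A \<noteq> {..<length xs})"

lemma run_subset: "run a xs A \<Longrightarrow> A \<subseteq> {..<length xs}"
  by (auto simp: run_def arc_def intro!: mod_less_divisor)

lemma run_rotate:
  assumes "run a (rotate k xs) A"
  shows "run a xs ((\<lambda>p. (p + k) mod length xs) ` A)"
proof -
  let ?n = "length xs"
  let ?s = "\<lambda>p. (p + k) mod ?n"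
  from assms obtain i l where il: "i < ?n" "1 < l" "l \<le> ?n" "A = arc ?n i l"
    and a: "\<forall>p\<in>A. rotate k xs ! p = a"
    by (auto simp: run_def)
  have "?s ` A = arc ?n (?s i) l"
    unfolding il(4) arc_def image_image
    by (rule image_cong) (simp_all add: mod_simps ac_simps)
  moreover have "?s i < ?n" using il(1) by (intro mod_less_divisor) linarith
  moreover have "\<forall>p\<in>?s ` A. xs ! p = a"
    proof
    fix q assume "q \<in> ?s ` A"
    then obtain p where p: "p \<in> A" "q = ?s p" by blast
    then have "p < ?n" using run_subset[OF assms] by auto
    then have "rotate k xs ! p = xs ! q" by (simp add: p(2) nth_rotate add.commute)
    then show "xs ! q = a" using a p(1) by simp
  qed
  ultimately show ?thesis
    using il unfolding run_def by blast
qed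

lemma shift_shift:
  assumes "A \<subseteq> {..<n}" "(j + k) mod n = 0"
  shows "(\<lambda>p. (p + k) mod n) ` (\<lambda>p. (p + j) mod n) ` A = (A :: nat set)"
proof -
  have "((p + j) mod n + k) mod n = p" if "p \<in> A" for p
  proof -
    have "((p + j) mod n + k) mod n = (p + (j + k) mod n) mod n"
      by (simp add: mod_simps ac_simps)
    then show ?thesis using that assms by auto
  qed
  then show ?thesis by (simp add: image_image)
qed

lemma clumps_rotate:
  "\<exists>j k'. (j + k') mod length xs = 0 \<and>
     (\<forall>a. clumps a (rotate k xs) = (\<lambda>A. (\<lambda>p. (p + j) mod length xs) ` A) ` clumps a xs) \<and>
     (\<lambda>p. (p + j) mod length xs) ` {..<length xs} = {..<length xs}"
proof -
  let ?n = "length xs"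
  let ?j = "if xs = [] then 0 else ?n - k mod ?n"
  have jk: "(?j + k) mod ?n = 0" if "xs \<noteq> []"
  proof -
    have "(?n - k mod ?n + k) mod ?n = (?n - k mod ?n + k mod ?n) mod ?n"
      by (simp add: mod_add_right_eq)
    also have "\<dots> = 0" using that by (simp add: less_imp_le)
    finally show ?thesis using that by simp
  qed
  show ?thesis
  proof (cases "xs = []")
    case True
    have "\<not> run a [] A" for a A by (auto simp: run_def)
    then show ?thesis using True by (auto simp: clumps_def intro!: exI[of _ 0])
  next
    case False
    define j where "j = ?j"
    have jk: "(j + k) mod ?n = 0" "(k + j) mod ?n = 0"
      using jk[OF False] by (simp_all add: j_def add.commute)
    let ?s = "\<lambda>A. (\<lambda>p. (p + k) mod ?n) ` A"
    let ?t = "\<lambda>A. (\<lambda>p. (p + j) mod ?n) ` A"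
    let ?ys = "rotate k xs"
    have undo: "rotate j ?ys = xs"
      using jk by (simp add: rotate_rotate rotate_conv_mod[of "j + k"])
    have st: "run a ?ys A \<Longrightarrow> run a xs (?s A)" for a A by (rule run_rotate)
    have ts: "run a xs A \<Longrightarrow> run a ?ys (?t A)" for a A
      using run_rotate[of a j ?ys A] undo by simp
    have i1: "run a xs A \<Longrightarrow> ?s (?t A) = A" for a A
      using shift_shift[OF run_subset jk(1)] by blast
    have i2: "run a ?ys A \<Longrightarrow> ?t (?s A) = A" for a A
      using shift_shift[OF _ jk(2)] run_subset[of a ?ys A] by simp
    have c1: "?t A \<in> clumps a ?ys" if "A \<in> clumps a xs" for a A
    proof -
      from that have A: "run a xs A" "\<And>B. run a xs B \<Longrightarrow> A \<subseteq> B \<Longrightarrow> B = A"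
        by (auto simp: clumps_def)
      have "B = ?t A" if B: "run a ?ys B" "?t A \<subseteq> B" for B
      proof -
        have "A \<subseteq> ?s B" using image_mono[OF B(2), of "\<lambda>p. (p + k) mod ?n"] i1[OF A(1)] by simp
        then have "?s B = A" using A(2) st[OF B(1)] by blast
        then show ?thesis using i2[OF B(1)] by simp
      qed
      then show ?thesis using ts[OF A(1)] by (auto simp: clumps_def)
    qed
    have c2: "?s A \<in> clumps a xs" if "A \<in> clumps a ?ys" for a A
    proof -
      from that have A: "run a ?ys A" "\<And>B. run a ?ys B \<Longrightarrow> A \<subseteq> B \<Longrightarrow> B = A"
        by (auto simp: clumps_def)
      have "B = ?s A" if B: "run a xs B" "?s A \<subseteq> B" for B
      proof -
        have "A \<subseteq> ?t B" using image_mono[OF B(2), of "\<lambda>p. (p + j) mod ?n"] i2[OF A(1)] by simp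
        then have "?t B = A" using A(2) ts[OF B(1)] by blast
        then show ?thesis using i1[OF B(1)] by simp
      qed
      then show ?thesis using st[OF A(1)] by (auto simp: clumps_def)
    qed
    have "clumps a ?ys = ?t ` clumps a xs" for a
    proof
      show "?t ` clumps a xs \<subseteq> clumps a ?ys" using c1 by blast
      show "clumps a ?ys \<subseteq> ?t ` clumps a xs"
      proof
        fix A assume A: "A \<in> clumps a ?ys"
        then have "run a ?ys A" by (simp add: clumps_def)
        then have "A = ?t (?s A)" using i2 by simp
        then show "A \<in> ?t ` clumps a xs" using c2[OF A] by blast
      qed
    qed
    moreover have "?t {..<?n} = {..<?n}"
    proof
      show "?t {..<?n} \<subseteq> {..<?n}" using False by auto
      have "{..<?n} = ?t (?s {..<?n})" by (rule shift_shift[OF _ jk(2), symmetric]) simp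
      also have "\<dots> \<subseteq> ?t {..<?n}" using False by (intro image_mono) auto
      finally show "{..<?n} \<subseteq> ?t {..<?n}" .
    qed
    ultimately show ?thesis using jk by (intro exI[of _ j] exI[of _ k]) simp
  qed
qed

lemma sole_proper_clump_rotate:
  assumes "sole_proper_clump (\<Union>a\<in>S. clumps a xs) xs"
  shows "sole_proper_clump (\<Union>a\<in>S. clumps a (rotate k xs)) (rotate k xs)"
proof -
  let ?n = "length xs"
  obtain j k' where jk: "(j + k') mod ?n = 0"
    and c: "\<And>a. clumps a (rotate k xs) = (\<lambda>A. (\<lambda>p. (p + j) mod ?n) ` A) ` clumps a xs"
    and w: "(\<lambda>p. (p + j) mod ?n) ` {..<?n} = {..<?n}"
    using clumps_rotate[of xs k]
    by (elim exE conjE) (rule that, assumption, erule spec, assumption)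
  obtain A where A: "(\<Union>a\<in>S. clumps a xs) = {A}" "A \<noteq> {..<?n}"
    using assms by (auto simp: sole_proper_clump_def)
  have sub: "A \<subseteq> {..<?n}"
  proof -
    have "A \<in> (\<Union>a\<in>S. clumps a xs)" using A(1) by simp
    then show ?thesis using run_subset by (auto simp: clumps_def)
  qed
  have "(\<Union>a\<in>S. clumps a (rotate k xs)) = (\<lambda>A. (\<lambda>p. (p + j) mod ?n) ` A) ` (\<Union>a\<in>S. clumps a xs)"
    by (simp add: c image_UN)
  also have "\<dots> = {(\<lambda>p. (p + j) mod ?n) ` A}" by (simp add: A(1))
  finally have "(\<Union>a\<in>S. clumps a (rotate k xs)) = {(\<lambda>p. (p + j) mod ?n) ` A}" .
  moreover have "(\<lambda>p. (p + j) mod ?n) ` A \<noteq> {..<?n}"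
  proof
    assume eq: "(\<lambda>p. (p + j) mod ?n) ` A = {..<?n}"
    have "A = (\<lambda>p. (p + k') mod ?n) ` (\<lambda>p. (p + j) mod ?n) ` A"
      by (rule shift_shift[OF sub jk, symmetric])
    also have "\<dots> = (\<lambda>p. (p + k') mod ?n) ` (\<lambda>p. (p + j) mod ?n) ` {..<?n}"
      unfolding eq w ..
    also have "\<dots> = {..<?n}"
      by (rule shift_shift[OF subset_refl jk])
    finally show False using A(2) by contradiction
  qed
  ultimately show ?thesis by (simp add: sole_proper_clump_def)
qed

lemma sole_proper_clump_rot_eq:
  assumes "rot_eq xs ys"
  shows "sole_proper_clump (\<Union>a\<in>S. clumps a xs) xs \<longleftrightarrow>
         sole_proper_clump (\<Union>a\<in>S. clumps a ys) ys"
proof -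
  obtain k where k: "ys = rotate k xs" using assms by (auto simp: rot_eq_def)
  obtain j where j: "rotate j ys = xs" using rotate_undo k by blast
  show ?thesis
    using sole_proper_clump_rotate[of xs S k] sole_proper_clump_rotate[of ys S j]
    unfolding k[symmetric] j by blast
qed

lift_definition one_clump :: "cyclic_seq \<Rightarrow> bool" is
  "\<lambda>xs. sole_proper_clump (clumps Up xs \<union> clumps Dn xs) xs"
  using sole_proper_clump_rot_eq[where S = "{Up, Dn}"] by simp

lift_definition suitable :: "cyclic_seq \<Rightarrow> bool" is
  "\<lambda>xs. sole_proper_clump (clumps Up xs) xs \<or> sole_proper_clump (clumps Dn xs) xs"
  using sole_proper_clump_rot_eq[where S = "{Up}"] sole_proper_clump_rot_eq[where S = "{Dn}"]
  by simp

definition partial_sum :: "letter list \<Rightarrow> nat \<Rightarrow> int" where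
  "partial_sum b i = (\<Sum>x\<leftarrow>take i b. expo x)"

definition is_block :: "nat \<Rightarrow> letter list \<Rightarrow> bool" where
  "is_block m b \<longleftrightarrow> partial_sum b (length b) = 0 \<and>
     (\<forall>i\<le>length b. - int m \<le> partial_sum b i \<and> partial_sum b i \<le> 0)"

definition full_block :: "nat \<Rightarrow> letter list \<Rightarrow> bool" where
  "full_block m b \<longleftrightarrow> is_block m b \<and> (\<exists>i\<le>length b. partial_sum b i = - int m)"

text \<open>The block \<open>bs ! i\<close> is inserted after the letter \<open>xs ! i\<close>.\<close>

definition blow_up :: "nat \<Rightarrow> cyclic_seq \<Rightarrow> cyclic_seq \<Rightarrow> bool" where
  "blow_up m S T \<longleftrightarrow> (\<exists>xs bs. S = cyc xs \<and> length bs = length xs \<and>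
     (\<forall>i<length xs. is_block m (bs ! i) \<and>
        (xs ! i = Dn \<and> xs ! (Suc i mod length xs) = Up \<longrightarrow> full_block m (bs ! i))) \<and>
     T = cyc (concat (map2 (#) xs bs)))"

definition CG_good :: "cyclic_seq \<Rightarrow> bool" where
  "CG_good T \<longleftrightarrow> (\<exists>n. one_clump ((magnus_D ^^ n) T))"

text \<open>The shape \<open>t t\<^sup>-\<^sup>1\<close> is amenable by convention.\<close>

definition amenable :: "cyclic_seq \<Rightarrow> bool" where
  "amenable T \<longleftrightarrow> (\<exists>m S. suitable S \<and> blow_up m S T) \<or> T = cyc [Up, Dn]"

end

theory Submission
  imports Defs
begin

text \<open>
  If \<open>D(T)\<close> is an \<open>m\<close>-blow up of a nonempty \<open>S\<close>, then \<open>T\<close> is an \<open>(m + 1)\<close>-blow up of the same \<open>S\<close>;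
  iterating from the trivial \<open>0\<close>-blow up, \<open>T\<close> is an \<open>n\<close>-blow up of \<open>D\<^sup>n(T)\<close>, and one-clump shapes are
  suitable.  For the key step, a letter of \<open>D(T)\<close> is a pair of equal consecutive letters of \<open>T\<close>.
  Represent each letter of \<open>S\<close> in \<open>T\<close> by the second member of its pair if it is \<open>t\<close> and by
  the first member if it is \<open>t\<^sup>-\<^sup>1\<close>.  The heights of a word \<open>w\<^sub>1\<dots>w\<^sub>j\<close> and of its linear derivative
  differ by \<open>(w\<^sub>1 + w\<^sub>j) / 2\<close>, so the words left over between these representatives are
  \<open>(m + 1)\<close>-blocks, full wherever they have to be.  The inclusion is strict because of
  \<open>t t\<^sup>-\<^sup>1\<close>, whose derivative is empty.
\<close>

subsection \<open>Linear derivatives\<close>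

definition height :: "letter list \<Rightarrow> int" where
  "height w = (\<Sum>x\<leftarrow>w. expo x)"

lemma height_simps [simp]:
  "height [] = 0" "height (x # w) = expo x + height w" "height (u @ v) = height u + height v"
  by (simp_all add: height_def)

fun linear_deriv :: "letter list \<Rightarrow> letter list" where
  "linear_deriv (x # y # w) = (if x = y then [x] else []) @ linear_deriv (y # w)"
| "linear_deriv w = []"

text \<open>The cut letter \<open>x\<close> lies in both factors, so each consecutive pair falls
  into exactly one of them.\<close>

lemma linear_deriv_append:
  "linear_deriv (u @ x # v) = linear_deriv (u @ [x]) @ linear_deriv (x # v)"
  by (induction u rule: linear_deriv.induct) simp_all

text \<open>Repeating the first letter at the end turns the cyclic pair of last and first letter
  into an ordinary one.\<close>

lemma deriv_list_eq_linear_deriv: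
  assumes "xs \<noteq> []"
  shows "deriv_list xs = linear_deriv (xs @ [hd xs])"
proof -
  have "map fst (filter (\<lambda>(a, b). a = b) (zip (x # ys) (ys @ [z]))) =
      linear_deriv (x # ys @ [z])" for x z ys
    by (induction ys arbitrary: x) auto
  with assms show ?thesis by (cases xs) (simp_all add: deriv_list_def)
qed

text \<open>A pair \<open>x\<close>, \<open>y\<close> contributes half of
  \<open>expo x + expo y\<close> to the height of the derivative, so in the sum the two ends each
  miss one half. Doubling avoids fractions.\<close>

lemma height_linear_deriv:
  "w \<noteq> [] \<Longrightarrow> 2 * height w = 2 * height (linear_deriv w) + expo (hd w) + expo (last w)"
proof (induction w rule: linear_deriv.induct)
  case (1 x y w)
  then show ?case by (cases x; cases y) simp_all
qed simp_all

text \<open>Lifts a prefix of the derivative to a prefix of \<open>w\<close>; this carries the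
  lowest point of a full block over to \<open>w\<close>.\<close>

lemma linear_deriv_eq_append:
  assumes "linear_deriv w = u @ v" "w \<noteq> []"
  shows "\<exists>p x q. w = p @ x # q \<and> linear_deriv (p @ [x]) = u"
  using assms
proof (induction w arbitrary: u rule: linear_deriv.induct)
  case (1 x y w)
  show ?case
  proof (cases "u = []")
    case True
    then show ?thesis by (intro exI[of _ "[]"]) simp
  next
    case False
    obtain u' where u': "u = (if x = y then [x] else []) @ u'" "linear_deriv (y # w) = u' @ v"
      using 1(2) False by (cases u) (auto split: if_splits)
    then obtain p z q where p: "y # w = p @ z # q" "linear_deriv (p @ [z]) = u'"
      using 1(1) by blast
    have "p @ [z] = y # tl (p @ [z])" using p(1) by (cases p) auto
    then have "linear_deriv (x # p @ [z]) = u"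
      using u'(1) p(2) by (metis linear_deriv.simps(1))
    then show ?thesis using p(1) by (intro exI[of _ "x # p"]) auto
  qed
qed (auto intro: exI[of _ "[]"])

text \<open>The letter \<open>s\<close> comes from a pair \<open>s\<close>, \<open>s\<close>;
  cutting \<open>w\<close> between its two members separates what precedes \<open>s\<close> in the
  derivative from what follows it.\<close>

lemma linear_deriv_eq_append_Cons:
  assumes "linear_deriv w = u @ s # v"
  shows "\<exists>p q. w = p @ s # s # q \<and> linear_deriv (p @ [s]) = u \<and> linear_deriv (s # q) = v"
  using assms
proof (induction w arbitrary: u rule: linear_deriv.induct)
  case (1 x y w)
  show ?case
  proof (cases "x = y \<and> u = []")
    case True
    then have "x # y # w = [] @ s # s # w" "linear_deriv ([] @ [s]) = u"
      "linear_deriv (s # w) = v"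
      using 1(2) True by auto
    then show ?thesis by blast
  next
    case False
    obtain u' where u': "u = (if x = y then [x] else []) @ u'"
      "linear_deriv (y # w) = u' @ s # v"
      using 1(2) False by (cases u) (auto split: if_splits)
    then obtain p q where p: "y # w = p @ s # s # q" "linear_deriv (p @ [s]) = u'"
      "linear_deriv (s # q) = v"
      using 1(1) by blast
    have "p @ [s] = y # tl (p @ [s])" using p(1) by (cases p) auto
    then have "linear_deriv (x # p @ [s]) = u"
      using u'(1) p(2) by (metis linear_deriv.simps(1))
    moreover have "x # y # w = (x # p) @ s # s # q" using p(1) by simp
    ultimately show ?thesis using p(3) by (metis append_Cons)
  qed
qed auto

subsection \<open>Blocks\<close>

lemma partial_sum_eq_height: "partial_sum b i = height (take i b)"
  by (simp add: partial_sum_def height_def)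

lemma is_block_iff:
  "is_block m b \<longleftrightarrow>
     height b = 0 \<and> (\<forall>u v. b = u @ v \<longrightarrow> - int m \<le> height u \<and> height u \<le> 0)"
proof -
  have "(\<forall>i\<le>length b. P (take i b)) \<longleftrightarrow> (\<forall>u v. b = u @ v \<longrightarrow> P u)" for P
    by (metis append_eq_conv_conj append_take_drop_id le_add1 length_append)
  from this[of "\<lambda>u. - int m \<le> height u \<and> height u \<le> 0"] show ?thesis
    by (simp add: is_block_def partial_sum_eq_height)
qed

lemma full_block_iff:
  "full_block m b \<longleftrightarrow> is_block m b \<and> (\<exists>u v. b = u @ v \<and> height u = - int m)"
proof -
  have "(\<exists>i\<le>length b. P (take i b)) \<longleftrightarrow> (\<exists>u v. b = u @ v \<and> P u)" for P
    by (metis append_eq_conv_conj append_take_drop_id le_add1 length_append)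
  from this[of "\<lambda>u. height u = - int m"] show ?thesis
    by (simp add: full_block_def partial_sum_eq_height)
qed

text \<open>The letters \<open>a\<close> and \<open>c\<close> are the neighbours of the block in the
  original shape.\<close>

definition block_between :: "nat \<Rightarrow> letter \<Rightarrow> letter list \<Rightarrow> letter \<Rightarrow> bool" where
  "block_between m a b c \<longleftrightarrow> is_block m b \<and> (a = Dn \<and> c = Up \<longrightarrow> full_block m b)"

text \<open>
  A letter \<open>s\<close> of \<open>S\<close> that gives rise to a pair \<open>s s\<close> in \<open>T\<close> is represented by the second member
  if \<open>s = Up\<close> and by the first one if \<open>s = Dn\<close>: cutting the pair in the middle, the
  representative lies at the start of the right part or at the end of the left part.
\<close>

fun right_part :: "letter \<Rightarrow> letter list" where
  "right_part Up = [Up]"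
| "right_part Dn = []"

fun left_part :: "letter \<Rightarrow> letter list" where
  "left_part Up = []"
| "left_part Dn = [Dn]"

lemma left_right_part: "left_part s @ right_part s = [s]"
  by (cases s) simp_all

text \<open>A prefix of \<open>w\<close> ending in \<open>x\<close> has the height of a prefix of
  the derivative plus half of \<open>expo a + expo x\<close>. Heights in [-m, 0] thus become heights
  in [-m, 1] if \<open>a = Up\<close> and in [-m - 1, 0] if \<open>a = Dn\<close>; removing the
  leading \<open>Up\<close> shifts the former range down by one.\<close>

lemma block_between_integral:
  assumes b: "block_between m a (linear_deriv w) c"
    and w: "w \<noteq> []" "hd w = a" "last w = c"
  shows "\<exists>v. w = right_part a @ v @ left_part c \<and> block_between (Suc m) a v c"
proof -
  have bl: "is_block m (linear_deriv w)" using b by (simp add: block_between_def)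
  have hw: "2 * height w = expo a + expo c"
    using height_linear_deriv[OF w(1)] w bl by (simp add: is_block_iff)
  have pre: "\<exists>d. - int m \<le> d \<and> d \<le> 0 \<and> 2 * height (p @ [x]) = 2 * d + expo a + expo x"
    if "w = p @ x # q" for p x q
  proof -
    have "linear_deriv w = linear_deriv (p @ [x]) @ linear_deriv (x # q)"
      unfolding that by (rule linear_deriv_append)
    then have "- int m \<le> height (linear_deriv (p @ [x]))" "height (linear_deriv (p @ [x])) \<le> 0"
      using bl by (simp_all add: is_block_iff)
    moreover have "hd (p @ [x]) = a" using w(2) that by (cases p) auto
    ultimately show ?thesis using height_linear_deriv[of "p @ [x]"] by auto
  qed
  have bounds: "(if a = Up then - int m else - int m - 1) \<le> height u \<and>
      height u \<le> (if a = Up then 1 else 0)" if u: "w = u @ v" "u \<noteq> []" for u v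
  proof -
    obtain p x where u': "u = p @ [x]" using u(2) by (metis rev_exhaust)
    then show ?thesis using pre[of p x v] u(1) by (cases a; cases x) auto
  qed
  \<comment> \<open>Letters are removed at both ends only if \<open>a = Up\<close> and
    \<open>c = Dn\<close>; as these differ, \<open>w\<close> then has at least two letters.\<close>
  have "\<exists>v. w = right_part a @ v @ left_part c"
  proof (cases a)
    case Up
    then obtain w' where w': "w = Up # w'" using w by (cases w) auto
    show ?thesis
    proof (cases c)
      case Dn
      then show ?thesis using w w' Up by (cases w' rule: rev_cases) auto
    qed (use Up w' in auto)
  next
    case Dn
    then show ?thesis
    proof (cases c)
      case Dn': Dn
      then show ?thesis using w Dn by (cases w rule: rev_cases) auto
    qed auto
  qed
  then obtain v where v: "w = right_part a @ v @ left_part c" by blast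
  have v0: "height v = 0" using hw v by (cases a; cases c) auto
  have block: "is_block (Suc m) v"
    unfolding is_block_iff
  proof (intro conjI allI impI)
    fix p q assume vq: "v = p @ q"
    have wpq: "w = (right_part a @ p) @ (q @ left_part c)" using v vq by simp
    have "- int (Suc m) \<le> height p \<and> height p \<le> 0"
    proof (cases "right_part a @ p = []")
      case False
      show ?thesis using bounds[OF wpq False] by (cases a) auto
    qed auto
    then show "- int (Suc m) \<le> height p" "height p \<le> 0" by auto
  qed (rule v0)
  \<comment> \<open>The lift \<open>p @ [x]\<close> of a lowest prefix of the derivative has height
    -m - 1 if \<open>x = Dn\<close>; if \<open>x = Up\<close>, it has height -m and \<open>p\<close>
    alone reaches -m - 1.\<close>
  have "full_block (Suc m) v" if ac: "a = Dn" "c = Up"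
  proof -
    have "full_block m (linear_deriv w)" using b ac by (simp add: block_between_def)
    then obtain d e where d: "linear_deriv w = d @ e" "height d = - int m"
      by (auto simp: full_block_iff)
    then obtain p x q where p: "w = p @ x # q" "linear_deriv (p @ [x]) = d"
      using linear_deriv_eq_append w(1) by blast
    have "hd (p @ [x]) = a" using w(2) p by (cases p) auto
    then have h: "2 * height (p @ [x]) = - 2 * int m + expo a + expo x"
      using height_linear_deriv[of "p @ [x]"] p(2) d(2) by simp
    have "\<exists>u v'. v = u @ v' \<and> height u = - int (Suc m)"
    proof (cases x)
      case Up
      then have "v = p @ x # q" "height p = - int (Suc m)" using h ac v p(1) by auto
      then show ?thesis by blast
    next
      case Dn
      then have "v = (p @ [x]) @ q" "height (p @ [x]) = - int (Suc m)" using h ac v p(1) by auto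
      then show ?thesis by blast
    qed
    then show ?thesis using block by (auto simp: full_block_iff)
  qed
  then show ?thesis using v block by (auto simp: block_between_def)
qed

subsection \<open>Blow-ups\<close>

text \<open>Each letter is paired with the block inserted after it.\<close>

definition flatten :: "(letter \<times> letter list) list \<Rightarrow> letter list" where
  "flatten ps = concat (map (\<lambda>(s, b). s # b) ps)"

lemma flatten_simps [simp]:
  "flatten [] = []" "flatten ((s, b) # ps) = s # b @ flatten ps"
  by (simp_all add: flatten_def)

text \<open>The argument \<open>c\<close> is the letter following the last block.\<close>

fun blocks :: "nat \<Rightarrow> (letter \<times> letter list) list \<Rightarrow> letter \<Rightarrow> bool" where
  "blocks m [] c \<longleftrightarrow> True"
| "blocks m ((s, b) # ps) c \<longleftrightarrow> block_between m s b (hd (map fst ps @ [c])) \<and> blocks m ps c"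

lemma blocks_iff:
  "blocks m ps c \<longleftrightarrow>
     (\<forall>i<length ps. block_between m (fst (ps ! i)) (snd (ps ! i)) ((map fst ps @ [c]) ! Suc i))"
proof (induction ps)
  case (Cons p ps)
  then show ?case
    by (cases p) (simp add: All_less_Suc2 hd_conv_nth)
qed simp

text \<open>Recasts the indexed definition in a form suited to induction; cyclically, the letter
  after the last block is the first one.\<close>

lemma blow_up_iff:
  "blow_up m S T \<longleftrightarrow>
     (\<exists>ps. S = cyc (map fst ps) \<and> T = cyc (flatten ps) \<and> blocks m ps (hd (map fst ps)))"
proof -
  have next_letter: "(xs @ [hd xs]) ! Suc i = xs ! (Suc i mod length xs)"
    if "i < length xs" for i and xs :: "letter list"
  proof (cases "Suc i < length xs")
    case False
    then have "Suc i = length xs" using that by simp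
    then show ?thesis using that by (metis hd_conv_nth length_greater_0_conv mod_self
      nth_append_length not_less_zero list.size(3))
  qed (simp add: nth_append)
  have blocks: "blocks m (zip xs bs) (hd xs) \<longleftrightarrow>
      (\<forall>i<length xs. is_block m (bs ! i) \<and>
        (xs ! i = Dn \<and> xs ! (Suc i mod length xs) = Up \<longrightarrow> full_block m (bs ! i)))"
    if "length bs = length xs" for xs bs
    using that next_letter by (auto simp: blocks_iff block_between_def)
  have flat: "concat (map2 (#) xs bs) = flatten (zip xs bs)" for xs bs
    by (simp add: flatten_def)
  show ?thesis
  proof
    assume "blow_up m S T"
    then obtain xs bs where "S = cyc xs" "length bs = length xs"
      "blocks m (zip xs bs) (hd xs)" "T = cyc (flatten (zip xs bs))"
      unfolding blow_up_def flat using blocks by blast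
    then show "\<exists>ps. S = cyc (map fst ps) \<and> T = cyc (flatten ps) \<and>
        blocks m ps (hd (map fst ps))"
      by (intro exI[of _ "zip xs bs"]) simp
  next
    assume "\<exists>ps. S = cyc (map fst ps) \<and> T = cyc (flatten ps) \<and> blocks m ps (hd (map fst ps))"
    then obtain ps where ps: "S = cyc (map fst ps)" "T = cyc (flatten ps)"
      "blocks m ps (hd (map fst ps))" by blast
    then show "blow_up m S T"
      unfolding blow_up_def flat using blocks[of "map snd ps" "map fst ps"]
      by (intro exI[of _ "map fst ps"] exI[of _ "map snd ps"]) (simp add: zip_map_fst_snd)
  qed
qed

lemma cyc_exhaust:
  obtains xs where "T = cyc xs"
  by (metis Quotient_abs_rep Quotient_cyclic_seq)

text \<open>The empty word is a full 0-block, so it may be inserted everywhere.\<close>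

lemma blow_up_refl: "blow_up 0 S S"
proof -
  obtain xs where xs: "S = cyc xs" by (rule cyc_exhaust)
  have "flatten (map (\<lambda>s. (s, [])) xs) = xs" by (induction xs) simp_all
  moreover have "block_between 0 a [] c" for a c
    by (simp add: block_between_def full_block_iff is_block_iff)
  then have "blocks 0 (map (\<lambda>s. (s, [])) xs) c" for c
    by (induction xs) simp_all
  ultimately show ?thesis
    unfolding blow_up_iff xs by (intro exI[of _ "map (\<lambda>s. (s, [])) xs"]) (simp add: comp_def)
qed

text \<open>The word \<open>s # z\<close> starts in the middle of the pair behind \<open>s\<close>
  and ends in the middle of the pair behind \<open>c\<close>. The pair behind the next letter of the
  shape splits off a first piece, handled by \<open>block_between_integral\<close>; induction
  handles the rest.\<close>

lemma blocks_integral: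
  assumes "linear_deriv (s # z) = b @ flatten ps" "last (s # z) = c" "blocks m ((s, b) # ps) c"
  shows "\<exists>v qs. map fst qs = map fst ps \<and>
    s # z = right_part s @ v @ flatten qs @ left_part c \<and> blocks (Suc m) ((s, v) # qs) c"
  using assms
proof (induction ps arbitrary: s z b)
  case Nil
  then show ?case using block_between_integral[of m s "s # z" c] by auto
next
  case (Cons p ps)
  obtain s' b' where p: "p = (s', b')" by (cases p)
  then obtain y z' where y: "s # z = y @ s' # s' # z'" "linear_deriv (y @ [s']) = b"
    "linear_deriv (s' # z') = b' @ flatten ps"
    using Cons.prems(1) linear_deriv_eq_append_Cons[of "s # z" b s'] by auto
  have "last (s' # z') = c" using Cons.prems(2) y(1) by simp
  then obtain v' qs where q: "map fst qs = map fst ps"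
    "s' # z' = right_part s' @ v' @ flatten qs @ left_part c" "blocks (Suc m) ((s', v') # qs) c"
    using Cons.IH[OF y(3)] Cons.prems(3) p by auto
  have "hd (y @ [s']) = s" using y(1) by (cases y) auto
  then obtain v where v: "y @ [s'] = right_part s @ v @ left_part s'"
    "block_between (Suc m) s v s'"
    using block_between_integral[of m s "y @ [s']" s'] Cons.prems(3) p y(2) by auto
  \<comment> \<open>At the cut, the first piece keeps \<open>left_part s'\<close> and the rest keeps
    \<open>right_part s'\<close>; together they are the single representative of
    \<open>s'\<close>.\<close>
  have "s # z = (y @ [s']) @ s' # z'" using y(1) by simp
  also have "\<dots> = right_part s @ v @ (left_part s' @ right_part s') @ v' @ flatten qs @ left_part c"
    unfolding v(1) q(2) by simp
  finally show ?case
    unfolding left_right_part using p q v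
    by (intro exI[of _ v] exI[of _ "(s', v') # qs"]) simp
qed

section \<open>From linear to cyclic words\<close>

lemma cyc_eq_iff: "cyc xs = cyc ys \<longleftrightarrow> (\<exists>u v. xs = u @ v \<and> ys = v @ u)"
proof -
  have "cyc xs = cyc ys \<longleftrightarrow> rot_eq xs ys"
    by (rule cyclic_seq.abs_eq_iff)
  also have "\<dots> \<longleftrightarrow> (\<exists>u v. xs = u @ v \<and> ys = v @ u)"
    unfolding rot_eq_def by (metis append_take_drop_id rotate_append rotate_drop_take)
  finally show ?thesis .
qed

lemma cyc_append_commute: "cyc (u @ v) = cyc (v @ u)"
  by (auto simp: cyc_eq_iff)

text \<open>The cyclic word is opened in the middle of the pair behind \<open>s\<close>: only this
  pair is lost, and all others remain in order.\<close>

lemma magnus_D_eq_cyc_Cons: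
  assumes "magnus_D (cyc xs) = cyc (s # r)"
  shows "\<exists>z. cyc xs = cyc (s # z) \<and> last (s # z) = s \<and> linear_deriv (s # z) = r"
proof -
  have "cyc (s # r) = cyc (deriv_list xs)" using assms by (simp add: magnus_D.abs_eq)
  then obtain u' v' where uv': "s # r = u' @ v'" "deriv_list xs = v' @ u'"
    by (auto simp: cyc_eq_iff)
  obtain u v where uv: "deriv_list xs = u @ s # v" "r = v @ u"
  proof (cases u')
    case Nil
    then show ?thesis using uv' by (intro that[of "[]" r]) auto
  next
    case (Cons a u'')
    then show ?thesis using uv' by (intro that[of v' u'']) auto
  qed
  have "xs \<noteq> []" using uv(1) by (auto simp: deriv_list_def)
  then obtain y z where y: "xs @ [hd xs] = y @ s # s # z"
    "linear_deriv (y @ [s]) = u" "linear_deriv (s # z) = v"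
    using linear_deriv_eq_append_Cons uv(1) deriv_list_eq_linear_deriv by metis
  show ?thesis
  \<comment> \<open>If \<open>z\<close> is empty, the pair consists of the last and the first
    letter, and \<open>xs\<close> is already cut there. Otherwise \<open>z\<close> ends in the
    repeated first letter \<open>h\<close>, where the two pieces are joined after rotation.\<close>
  proof (cases z rule: rev_cases)
    case Nil
    have ys: "xs = y @ [s]" "hd xs = s" using y(1) Nil by auto
    then have "xs = s # tl xs" by (metis hd_Cons_tl append_is_Nil_conv not_Cons_self2)
    moreover have "last xs = s" "linear_deriv xs = r" using ys(1) y uv(2) Nil by auto
    ultimately show ?thesis by metis
  next
    case (snoc z' h)
    have ys: "xs = y @ s # s # z'" "hd xs = h" using y(1) snoc by auto
    then obtain y' where y': "y @ [s] = h # y'" by (cases y) auto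
    have "linear_deriv (s # z' @ y @ [s]) = linear_deriv ((s # z') @ h # y')" using y' by simp
    also have "\<dots> = v @ u"
      using linear_deriv_append[of "s # z'" h y'] y(2,3) y' snoc by simp
    finally have "linear_deriv (s # z' @ y @ [s]) = r" using uv(2) by simp
    moreover have "cyc xs = cyc (s # z' @ y @ [s])"
      using cyc_append_commute[of "y @ [s]" "s # z'"] ys(1) by simp
    ultimately show ?thesis by (intro exI[of _ "z' @ y @ [s]"]) simp
  qed
qed

text \<open>As \<open>S\<close> is nonempty, it has a letter \<open>s\<close> at whose pair
  \<open>T\<close> can be opened.\<close>

lemma blow_up_magnus_D:
  assumes "blow_up m S (magnus_D T)" "width S \<noteq> 0"
  shows "blow_up (Suc m) S T"
proof -
  obtain ps where ps: "S = cyc (map fst ps)" "magnus_D T = cyc (flatten ps)"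
    "blocks m ps (hd (map fst ps))"
    using assms(1) by (auto simp: blow_up_iff)
  have "ps \<noteq> []" using assms(2) ps(1) by (auto simp: width.abs_eq)
  then obtain s b ps' where ps': "ps = (s, b) # ps'" by (cases ps) auto
  obtain xs where xs: "T = cyc xs" by (rule cyc_exhaust)
  obtain z where z: "T = cyc (s # z)" "last (s # z) = s"
    "linear_deriv (s # z) = b @ flatten ps'"
    using magnus_D_eq_cyc_Cons[of xs s] ps(2) ps' xs by auto
  obtain v qs where v: "map fst qs = map fst ps'"
    "s # z = right_part s @ v @ flatten qs @ left_part s" "blocks (Suc m) ((s, v) # qs) s"
    using blocks_integral[OF z(3,2), of m] ps(3) ps' by auto
  \<comment> \<open>Rotating \<open>left_part s\<close> to the front restores the representative of
    \<open>s\<close>.\<close>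
  have "cyc (s # z) = cyc ((left_part s @ right_part s) @ v @ flatten qs)"
    using cyc_append_commute[of "right_part s @ v @ flatten qs" "left_part s"] v(2) by simp
  then have "T = cyc (flatten ((s, v) # qs))" using z(1) by (simp add: left_right_part)
  then show ?thesis
    unfolding blow_up_iff using v ps(1) ps' by (intro exI[of _ "(s, v) # qs"]) simp
qed

text \<open>Induction peels off the innermost derivative, so the hypothesis is applied to
  \<open>magnus_D T\<close>.\<close>

lemma blow_up_funpow_magnus_D:
  "width ((magnus_D ^^ n) T) \<noteq> 0 \<Longrightarrow> blow_up n ((magnus_D ^^ n) T) T"
proof (induction n arbitrary: T)
  case 0
  then show ?case using blow_up_refl by simp
next
  case (Suc n)
  then show ?case
    using blow_up_magnus_D Suc.IH[of "magnus_D T"] by (simp add: funpow_Suc_right del: funpow.simps)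
qed

subsection \<open>Comparison of the two classes\<close>

lemma one_clump_imp_suitable: "one_clump T \<Longrightarrow> suitable T"
proof transfer
  fix xs assume "sole_proper_clump (clumps Up xs \<union> clumps Dn xs) xs"
  then obtain A where "clumps Up xs \<union> clumps Dn xs = {A}" "A \<noteq> {..<length xs}"
    by (auto simp: sole_proper_clump_def)
  moreover from this have "clumps Up xs = {A} \<or> clumps Dn xs = {A}" by blast
  ultimately show "sole_proper_clump (clumps Up xs) xs \<or> sole_proper_clump (clumps Dn xs) xs"
    by (auto simp: sole_proper_clump_def)
qed

lemma one_clump_imp_run:
  assumes "one_clump (cyc xs)"
  shows "\<exists>a A. run a xs A"
proof -
  have "sole_proper_clump (clumps Up xs \<union> clumps Dn xs) xs"
    using assms by (simp add: one_clump.abs_eq)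
  then obtain A where "clumps Up xs \<union> clumps Dn xs = {A}"
    by (auto simp: sole_proper_clump_def)
  then have "A \<in> clumps Up xs \<union> clumps Dn xs" by simp
  then show ?thesis by (auto simp: clumps_def)
qed

lemma width_one_clump: "one_clump T \<Longrightarrow> width T \<noteq> 0"
proof
  assume T: "one_clump T" "width T = 0"
  obtain xs where xs: "T = cyc xs" by (rule cyc_exhaust)
  then obtain a A where "run a xs A" using T one_clump_imp_run by blast
  then show False using T xs by (auto simp: run_def width.abs_eq)
qed

lemma CG_good_imp_amenable:
  assumes "CG_good T"
  shows "amenable T"
  using assms blow_up_funpow_magnus_D one_clump_imp_suitable width_one_clump
  unfolding CG_good_def amenable_def by blast

text \<open>In a word of width 2 a run covers both positions, but the two letters differ; all
  further derivatives are empty.\<close>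

lemma not_CG_good_Up_Dn: "\<not> CG_good (cyc [Up, Dn])"
proof
  assume "CG_good (cyc [Up, Dn])"
  then obtain n where n: "one_clump ((magnus_D ^^ n) (cyc [Up, Dn]))"
    by (auto simp: CG_good_def)
  show False
  proof (cases n)
    case 0
    then obtain a A where "run a [Up, Dn] A" using n one_clump_imp_run by fastforce
    then obtain i l where il: "i < 2" "1 < l" "l \<le> 2" "A = arc 2 i l"
      and a: "\<forall>p\<in>A. [Up, Dn] ! p = a"
      by (auto simp: run_def numeral_2_eq_2)
    have "i = 0 \<or> i = 1" "l = 2" using il by auto
    then have "A = {0, 1}" unfolding il(4) by (auto simp: arc_def lessThan_nat_numeral lessThan_Suc)
    then show False using a by auto
  next
    case (Suc k)
    have "magnus_D (cyc [Up, Dn]) = cyc []"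
      by (simp add: magnus_D.abs_eq deriv_list_def)
    moreover have "magnus_D (cyc []) = cyc []"
      by (simp add: magnus_D.abs_eq deriv_list_def)
    then have "(magnus_D ^^ k) (cyc []) = cyc []" by (induction k) simp_all
    ultimately have "(magnus_D ^^ n) (cyc [Up, Dn]) = cyc []"
      using Suc by (simp add: funpow_Suc_right del: funpow.simps)
    then show False using n width_one_clump by (metis list.size(3) width.abs_eq)
  qed
qed

theorem corollary4p2:
  "{T \<in> cyclic_shapes. CG_good T} \<subset> {T \<in> cyclic_shapes. amenable T}"
proof -
  have "cyc [Up, Dn] \<in> cyclic_shapes" "amenable (cyc [Up, Dn])"
    by (simp_all add: cyclic_shapes_def width.abs_eq amenable_def)
  then show ?thesis using CG_good_imp_amenable not_CG_good_Up_Dn by blast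
qed

end
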